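(* Let $p$ be a prime. The ring $\mathbb{Z}[1/p]$ admits a 4-cycle if and only if $p=2$ or $p=3$.
   Context: A set of primes $\{p_1,\dots,p_n\}$ is said to admit a 4-cycle if there exist signs $\epsilon_1,\epsilon_2,\epsilon_3,\epsilon_4\in\{-1,1\}$ and integers $u_i=p_1^{a_{i1}}\cdots p_n^{a_{in}}$ ($1\le i\le 4$), with every $a_{ij}$ a nonnegative integer, such that $\epsilon_1u_1+\epsilon_2u_2+\epsilon_3u_3+\epsilon_4u_4=0$ and no proper nonempty subsum vanishes (i.e. $\sum_{i\in I}\epsilon_iu_i\neq 0$ for every $\emptyset\ne I\subsetneq\{1,2,3,4\}$). The $u_i$ need not be distinct. The ring $\mathbb{Z}[1/p_1,\dots,1/p_n]$ is said to admit a 4-cycle if the set of primes $\{p_1,\dots,p_n\}$ admits a 4-cycle. *)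

theory Defs
  imports Complex_Main "HOL-Computational_Algebra.Primes"
begin

definition admits_4_cycle :: "nat set \<Rightarrow> bool" where
  "admits_4_cycle P \<longleftrightarrow>
     (\<exists>(\<epsilon> :: nat \<Rightarrow> int) (u :: nat \<Rightarrow> int) (a :: nat \<Rightarrow> nat \<Rightarrow> nat).
        (\<forall>i\<in>{1..4}. \<epsilon> i \<in> {-1, 1}) \<and>
        (\<forall>i\<in>{1..4}. u i = (\<Prod>p\<in>P. int p ^ a i p)) \<and>
        (\<Sum>i\<in>{1..4}. \<epsilon> i * u i) = 0 \<and>
        (\<forall>I. I \<noteq> {} \<and> I \<subset> {1..4} \<longrightarrow> (\<Sum>i\<in>I. \<epsilon> i * u i) \<noteq> 0))"

text \<open>The ring obtained from the integers by adjoining the inverses of the elements of \<open>P\<close>,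
  as the subring of the rationals that these inverses generate.\<close>

inductive_set int_adjoin_inverses :: "nat set \<Rightarrow> rat set" for P :: "nat set" where
  one: "1 \<in> int_adjoin_inverses P"
| inv: "p \<in> P \<Longrightarrow> 1 / of_nat p \<in> int_adjoin_inverses P"
| diff: "x \<in> int_adjoin_inverses P \<Longrightarrow> y \<in> int_adjoin_inverses P \<Longrightarrow>
           x - y \<in> int_adjoin_inverses P"
| mult: "x \<in> int_adjoin_inverses P \<Longrightarrow> y \<in> int_adjoin_inverses P \<Longrightarrow>
           x * y \<in> int_adjoin_inverses P"

text \<open>The existential quantifier involves no choice: the primes in \<open>P\<close> are exactly the primes
  that are invertible in \<open>R\<close>, so \<open>R\<close> determines \<open>P\<close>.\<close>

definition ring_admits_4_cycle :: "rat set \<Rightarrow> bool" where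
  "ring_admits_4_cycle R \<longleftrightarrow>
     (\<exists>P. finite P \<and> (\<forall>p\<in>P. prime p) \<and> R = int_adjoin_inverses P \<and> admits_4_cycle P)"

end

theory Submission
  imports Defs
begin

text \<open>For \<open>p = 2\<close> use \<open>1 + 1 + 2 - 4 = 0\<close>, for \<open>p = 3\<close> use \<open>1 + 1 + 1 - 3 = 0\<close>. For \<open>p \<ge> 5\<close>, the signs of
  the terms with the least power of \<open>p\<close> add up to a multiple of \<open>p\<close> of absolute value at most
  \<open>4\<close>, hence to \<open>0\<close>. So these terms have vanishing sum and must be all four of them; but then the
  four terms are equal up to sign and cancel in pairs.\<close>

text \<open>Induction over the generation of the ring: the product of denominators of
  \<open>x\<close> and \<open>y\<close> clears both \<open>x - y\<close> and \<open>x * y\<close>,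
  and a prime dividing it divides one of the factors. The condition on prime divisors also controls
  \<open>b = 0\<close>: every prime divides 0, so this value can occur only when \<open>P\<close>
  contains all primes.\<close>

lemma int_adjoin_inverses_denominator:
  assumes "x \<in> int_adjoin_inverses P" "\<forall>p\<in>P. prime p"
  obtains b :: nat where "of_nat b * x \<in> \<int>" "\<And>q. prime q \<Longrightarrow> q dvd b \<Longrightarrow> q \<in> P"
proof -
  from assms(1) have "\<exists>b::nat. of_nat b * x \<in> \<int> \<and> (\<forall>q. prime q \<longrightarrow> q dvd b \<longrightarrow> q \<in> P)"
  proof induction
    case one
    show ?case by (rule exI[of _ 1]) auto
  next
    case (inv p)
    with assms(2) have p: "prime p" by blast
    then have "q \<in> P" if "prime q" "q dvd p" for q
      using that inv primes_dvd_imp_eq by blast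
    moreover have "of_nat p * (1 / of_nat p :: rat) \<in> \<int>"
      using p by (simp add: prime_gt_0_nat)
    ultimately show ?case by blast
  next
    case (diff x y)
    then obtain b c :: nat where bc:
      "of_nat b * x \<in> \<int>" "\<forall>q. prime q \<longrightarrow> q dvd b \<longrightarrow> q \<in> P"
      "of_nat c * y \<in> \<int>" "\<forall>q. prime q \<longrightarrow> q dvd c \<longrightarrow> q \<in> P"
      by blast
    have "of_nat (b * c) * (x - y) = of_nat c * (of_nat b * x) - of_nat b * (of_nat c * y)"
      by (simp add: algebra_simps)
    also have "\<dots> \<in> \<int>"
      by (rule Ints_diff[OF Ints_mult[OF Ints_of_nat bc(1)] Ints_mult[OF Ints_of_nat bc(3)]])
    finally show ?case using bc by (metis prime_dvd_mult_nat)
  next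
    case (mult x y)
    then obtain b c :: nat where bc:
      "of_nat b * x \<in> \<int>" "\<forall>q. prime q \<longrightarrow> q dvd b \<longrightarrow> q \<in> P"
      "of_nat c * y \<in> \<int>" "\<forall>q. prime q \<longrightarrow> q dvd c \<longrightarrow> q \<in> P"
      by blast
    have "of_nat (b * c) * (x * y) = (of_nat b * x) * (of_nat c * y)"
      by (simp add: algebra_simps)
    also have "\<dots> \<in> \<int>" by (rule Ints_mult[OF bc(1) bc(3)])
    finally show ?case using bc by (metis prime_dvd_mult_nat)
  qed
  then show thesis using that by blast
qed

text \<open>This recovers \<open>P\<close> from the ring, so that a question about the ring becomes
  one about \<open>P\<close>. Any \<open>b\<close> that clears the denominator of
  \<open>1 / q\<close> is a multiple of \<open>q\<close>, and the primes dividing a suitable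
  \<open>b\<close> lie in \<open>P\<close>.\<close>

lemma inverse_prime_in_int_adjoin_inverses_iff:
  assumes "\<forall>p\<in>P. prime p" "prime q"
  shows "1 / of_nat q \<in> int_adjoin_inverses P \<longleftrightarrow> q \<in> P"
proof
  assume "1 / of_nat q \<in> int_adjoin_inverses P"
  then obtain b :: nat where b: "of_nat b * (1 / of_nat q :: rat) \<in> \<int>"
    "\<And>r. prime r \<Longrightarrow> r dvd b \<Longrightarrow> r \<in> P"
    using int_adjoin_inverses_denominator assms(1) by blast
  from b(1) obtain k :: int where "of_nat b / of_nat q = (of_int k :: rat)"
    by (auto elim: Ints_cases)
  then have "(of_int (int b) :: rat) = of_int (k * int q)"
    using assms(2) by (simp add: field_simps prime_gt_0_nat)
  then have "int b = k * int q" by (simp only: of_int_eq_iff)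
  then have "int q dvd int b" by simp
  then show "q \<in> P" using b(2) assms(2) by simp
qed (rule int_adjoin_inverses.inv)

lemma int_adjoin_inverses_inject:
  assumes "\<forall>p\<in>P. prime p" "\<forall>p\<in>Q. prime p" "int_adjoin_inverses P = int_adjoin_inverses Q"
  shows "P = Q"
  using assms inverse_prime_in_int_adjoin_inverses_iff by blast

lemma ring_admits_4_cycle_iff:
  assumes "finite P" "\<forall>p\<in>P. prime p"
  shows "ring_admits_4_cycle (int_adjoin_inverses P) \<longleftrightarrow> admits_4_cycle P"
  unfolding ring_admits_4_cycle_def using assms int_adjoin_inverses_inject by metis

lemma atLeastAtMost_1_4: "{1..4::nat} = {1, 2, 3, 4}"
  by auto

text \<open>With a single negative term, no proper subsum can vanish: a nonempty sum avoiding index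
  4 is positive, and a sum containing index 4 is the negative of its complementary sum, which avoids
  4.\<close>

lemma admits_4_cycle_singletonI:
  assumes "p > 0" and eq: "p ^ a + p ^ b + p ^ c = p ^ d"
  shows "admits_4_cycle {p}"
proof -
  define e :: "nat \<Rightarrow> int" where "e = (\<lambda>i. if i = 4 then -1 else 1)"
  define k where "k = (\<lambda>i::nat. if i = 1 then a else if i = 2 then b else if i = 3 then c else d)"
  define t where "t = (\<lambda>i. e i * int p ^ k i)"
  have "int (p ^ a + p ^ b + p ^ c) = int (p ^ d)" using eq by simp
  then have zero: "(\<Sum>i\<in>{1..4}. t i) = 0"
    unfolding atLeastAtMost_1_4 by (simp add: t_def e_def k_def)
  have pos: "(\<Sum>i\<in>I. t i) > 0" if "I \<noteq> {}" "I \<subseteq> {1..4}" "4 \<notin> I" for I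
  proof (rule sum_pos)
    show "finite I" using that(2) finite_subset by blast
    show "t i > 0" if "i \<in> I" for i
      using that \<open>4 \<notin> I\<close> \<open>p > 0\<close> by (auto simp: t_def e_def)
  qed (fact that(1))
  have nonzero: "(\<Sum>i\<in>I. t i) \<noteq> 0" if I: "I \<noteq> {}" "I \<subset> {1..4}" for I
  proof (cases "4 \<in> I")
    case False
    then show ?thesis using pos[of I] I by auto
  next
    case True
    have "(\<Sum>i\<in>I. t i) = - (\<Sum>i\<in>{1..4} - I. t i)"
      using sum.subset_diff[of I "{1..4}" t] I zero by auto
    moreover have "(\<Sum>i\<in>{1..4} - I. t i) > 0" using I True by (intro pos) auto
    ultimately show ?thesis by simp
  qed
  have "\<forall>i\<in>{1..4}. e i \<in> {-1, 1}" by (simp add: e_def)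
  moreover have "\<forall>i\<in>{1..4}. int p ^ k i = (\<Prod>q\<in>{p}. int q ^ k i)" by simp
  ultimately show ?thesis
    unfolding admits_4_cycle_def using zero nonzero unfolding t_def
    by (intro exI[of _ e] exI[of _ "\<lambda>i. int p ^ k i"] exI[of _ "\<lambda>i _. k i"]) simp
qed

lemma admits_4_cycle_2: "admits_4_cycle {2}"
  by (rule admits_4_cycle_singletonI[of _ 0 0 1 2]) simp_all

lemma admits_4_cycle_3: "admits_4_cycle {3}"
  by (rule admits_4_cycle_singletonI[of _ 0 0 0 1]) simp_all

lemma not_admits_4_cycle:
  assumes "p > 4"
  shows "\<not> admits_4_cycle {p}"
proof
  assume "admits_4_cycle {p}"
  then obtain e u :: "nat \<Rightarrow> int" and a :: "nat \<Rightarrow> nat \<Rightarrow> nat"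
    where e_ball: "\<forall>i\<in>{1..4}. e i \<in> {-1, 1}"
      and u_ball: "\<forall>i\<in>{1..4}. u i = (\<Prod>q\<in>{p}. int q ^ a i q)"
      and zero: "(\<Sum>i\<in>{1..4}. e i * u i) = 0"
      and nonzero: "\<forall>I. I \<noteq> {} \<and> I \<subset> {1..4} \<longrightarrow> (\<Sum>i\<in>I. e i * u i) \<noteq> 0"
    unfolding admits_4_cycle_def by - (elim exE conjE, rule that)
  have e: "e i \<in> {-1, 1}" if "i \<in> {1..4}" for i
    using e_ball that by blast
  have u: "u i = int p ^ a i p" if "i \<in> {1..4}" for i
    using u_ball that by simp
  define m where "m = Min ((\<lambda>i. a i p) ` {1..4})"
  define S where "S = {i \<in> {1..4}. a i p = m}"
  have m_le: "m \<le> a i p" if "i \<in> {1..4}" for i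
    unfolding m_def using that by simp
  have "m \<in> (\<lambda>i. a i p) ` {1..4}" unfolding m_def by (intro Min_in) auto
  then have "S \<noteq> {}" by (auto simp: S_def)
  have S_sub: "S \<subseteq> {1..4}" by (auto simp: S_def)
  have sum_S: "(\<Sum>i\<in>S. e i * u i) = (\<Sum>i\<in>S. e i) * int p ^ m"
    unfolding sum_distrib_right by (rule sum.cong) (auto simp: S_def u)
  \<comment> \<open>Outside \<open>S\<close> the exponents exceed \<open>m\<close>. As the total is
    zero, the sum over \<open>S\<close> is divisible by the same power, and cancelling
    \<open>p ^ m\<close> leaves a factor \<open>p\<close> in the sum of signs.\<close>
  have "int p ^ Suc m dvd (\<Sum>i\<in>{1..4} - S. e i * u i)"
  proof (intro dvd_sum dvd_mult)
    fix i assume "i \<in> {1..4} - S"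
    then show "int p ^ Suc m dvd u i"
      using m_le[of i] by (auto simp: S_def u intro!: le_imp_power_dvd simp del: power_Suc)
  qed
  moreover have "(\<Sum>i\<in>S. e i * u i) = - (\<Sum>i\<in>{1..4} - S. e i * u i)"
    using sum.subset_diff[OF S_sub, of "\<lambda>i. e i * u i"] zero by simp
  ultimately have "int p ^ Suc m dvd (\<Sum>i\<in>S. e i) * int p ^ m"
    by (simp only: dvd_minus_iff flip: sum_S)
  then have dvd: "int p dvd (\<Sum>i\<in>S. e i)"
    using assms by simp
  have "\<bar>\<Sum>i\<in>S. e i\<bar> \<le> (\<Sum>i\<in>S. \<bar>e i\<bar>)" by (rule sum_abs)
  also have "\<dots> = (\<Sum>i\<in>S. 1)" by (rule sum.cong) (use e_ball S_sub in force)+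
  also have "\<dots> \<le> 4" using card_mono[OF _ S_sub] by simp
  \<comment> \<open>A nonzero multiple of \<open>p\<close> would have absolute value at least
    \<open>p > 4\<close>.\<close>
  finally have "(\<Sum>i\<in>S. e i) = 0"
    using dvd assms dvd_imp_le_int[of "\<Sum>i\<in>S. e i" "int p"] by linarith
  then have "(\<Sum>i\<in>S. e i * u i) = 0" using sum_S by simp
  then have S: "S = {1..4}" using nonzero \<open>S \<noteq> {}\<close> S_sub by blast
  have u_eq: "u i = int p ^ m" if "i \<in> {1..4}" for i
    using that u[OF that] S unfolding S_def by force
  have "e 1 + e 2 + e 3 + e 4 = 0"
    using \<open>(\<Sum>i\<in>S. e i) = 0\<close> unfolding S atLeastAtMost_1_4 by simp
  \<comment> \<open>Two signs are positive and two negative, so the sign opposite to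
    \<open>e 1\<close> occurs twice among indices 2, 3, 4, hence at least once among 2 and
    3.\<close>
  then have "e 1 + e 2 = 0 \<or> e 1 + e 3 = 0"
    using e[of 1] e[of 2] e[of 3] e[of 4] by auto
  then obtain j where j: "j \<in> {2, 3}" "e 1 + e j = 0" by blast
  have "(\<Sum>i\<in>{1, j}. e i * u i) = (e 1 + e j) * int p ^ m"
    using j(1) u_eq[of 1] u_eq[of j] by (auto simp: algebra_simps)
  moreover have "{1, j} \<subset> {1..4}" using j(1) unfolding atLeastAtMost_1_4 by auto
  ultimately have "(e 1 + e j) * int p ^ m \<noteq> 0"
    using nonzero by (metis insert_not_empty)
  then show False using j(2) by simp
qed

theorem theorem1p4:
  fixes p :: nat
  assumes "prime p"
  shows "ring_admits_4_cycle (int_adjoin_inverses {p}) \<longleftrightarrow> p = 2 \<or> p = 3"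
proof -
  \<comment> \<open>Between the two positive cases and the range \<open>p > 4\<close> of
    \<open>not_admits_4_cycle\<close>, only 4 remains to be excluded.\<close>
  have "p \<noteq> 4" using assms prime_product[of 2 2] by auto
  then have "p > 4 \<or> p = 2 \<or> p = 3" using prime_ge_2_nat[OF assms] by linarith
  then have "admits_4_cycle {p} \<longleftrightarrow> p = 2 \<or> p = 3"
    using not_admits_4_cycle admits_4_cycle_2 admits_4_cycle_3 by auto
  then show ?thesis using ring_admits_4_cycle_iff[of "{p}"] assms by simp
qed

end
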